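(* For all $n\in\mathbb{N}$ and all $s\in\mathbb{N}\cup\{0\}$, the graph $(2s+1)LK_{1,n}$ is super edge-magic.
   Context: Graphs are finite and undirected, may contain loops, but multiple edges are not allowed. $\mathbb{N}$ denotes the positive integers, and for integers $m\le n$, $[m,n]=\{m,m+1,\dots,n\}$. $LK_{1,n}$ is the graph obtained from the star $K_{1,n}$ (one central vertex joined to $n$ other vertices) by attaching a loop at its central vertex (for $n=1$: an edge with a loop at one of its two endpoints). For a positive integer $t$ and a graph $G$, $tG$ denotes the disjoint union of $t$ copies of $G$. Let $G$ be a graph with $p$ vertices and $q$ edges (loops count as edges). $G$ is edge-magic if there is a bijection $f:V(G)\cup E(G)\to[1,p+q]$ and a constant $k$ such that $f(x)+f(xy)+f(y)=k$ for every edge $xy\in E(G)$ (for a loop, $x=y$). $G$ is super edge-magic if there is such an $f$ with, in addition, $f(V(G))=[1,p]$. It is known that, equivalently, $G$ is super edge-magic if and only if there is a bijection $g:V(G)\to[1,p]$ such that $\{g(u)+g(v):uv\in E(G)\}$ is a set of $q$ consecutive integers (a loop at $u$ contributes $2g(u)$). *)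

theory Defs
  imports Main
begin

text \<open>
  An edge is the set of its endpoints, so that an undirected edge between distinct vertices
  \<open>x\<close>, \<open>y\<close> is \<open>{x, y}\<close>, a loop at \<open>x\<close> is the singleton \<open>{x, x} = {x}\<close>, and multiple edges
  (including multiple loops at a vertex) cannot occur.
\<close>

record 'a loop_graph =
  verts :: "'a set"
  edges :: "'a set set"

definition fin_loop_graph :: "'a loop_graph \<Rightarrow> bool" where
  "fin_loop_graph G \<longleftrightarrow>
     finite (verts G) \<and> (\<forall>e \<in> edges G. \<exists>x \<in> verts G. \<exists>y \<in> verts G. e = {x, y})"

definition star :: "nat \<Rightarrow> nat loop_graph" where
  "star n = \<lparr>verts = {0..n}, edges = {{0, i} | i. i \<in> {1..n}}\<rparr>"

definition attach_loop :: "'a \<Rightarrow> 'a loop_graph \<Rightarrow> 'a loop_graph" where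
  "attach_loop x G = \<lparr>verts = verts G, edges = insert {x, x} (edges G)\<rparr>"

definition LK :: "nat \<Rightarrow> nat loop_graph" where
  "LK n = attach_loop 0 (star n)"

definition copies :: "nat \<Rightarrow> 'a loop_graph \<Rightarrow> (nat \<times> 'a) loop_graph" where
  "copies t G =
     \<lparr>verts = {1..t} \<times> verts G,
      edges = {Pair j ` e | j e. j \<in> {1..t} \<and> e \<in> edges G}\<rparr>"

text \<open>
  The set \<open>V \<union> E\<close> is the disjoint sum \<open>V <+> E\<close>: vertices are labelled through \<open>Inl\<close>, edges
  through \<open>Inr\<close>. In the magic condition \<open>x = y\<close> is allowed and is the case of a loop.
\<close>

definition edge_magic_labeling :: "'a loop_graph \<Rightarrow> ('a + 'a set \<Rightarrow> nat) \<Rightarrow> nat \<Rightarrow> bool" where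
  "edge_magic_labeling G f k \<longleftrightarrow>
     bij_betw f (verts G <+> edges G) {1..card (verts G) + card (edges G)} \<and>
     (\<forall>x y. {x, y} \<in> edges G \<longrightarrow> f (Inl x) + f (Inr {x, y}) + f (Inl y) = k)"

definition edge_magic :: "'a loop_graph \<Rightarrow> bool" where
  "edge_magic G \<longleftrightarrow> (\<exists>f k. edge_magic_labeling G f k)"

definition super_edge_magic :: "'a loop_graph \<Rightarrow> bool" where
  "super_edge_magic G \<longleftrightarrow>
     (\<exists>f k. edge_magic_labeling G f k \<and> f ` Inl ` verts G = {1..card (verts G)})"

lemma fin_loop_graph_LK: "fin_loop_graph (LK n)"
  by (force simp: fin_loop_graph_def LK_def attach_loop_def star_def)

lemma fin_loop_graph_copies:
  assumes "fin_loop_graph G"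
  shows "fin_loop_graph (copies t G)"
  unfolding fin_loop_graph_def
proof (intro conjI ballI)
  show "finite (verts (copies t G))"
    using assms by (simp add: fin_loop_graph_def copies_def)
next
  fix e assume "e \<in> edges (copies t G)"
  then obtain j e' where j: "j \<in> {1..t}" "e' \<in> edges G" and e: "e = Pair j ` e'"
    by (auto simp: copies_def)
  then obtain x y where "x \<in> verts G" "y \<in> verts G" "e' = {x, y}"
    using assms unfolding fin_loop_graph_def by blast
  with j(1) e show "\<exists>x \<in> verts (copies t G). \<exists>y \<in> verts (copies t G). e = {x, y}"
    by (intro bexI[of _ "(j, x)"] bexI[of _ "(j, y)"]) (auto simp: copies_def)
qed

end

theory Submission
  imports Defs
begin

text \<open>
  Call the sum of the labels of the two ends of an edge (twice the label, for a loop) the weight of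
  that edge. If the vertices carry the labels \<open>1, \<dots>, p\<close> and the weights of the \<open>q\<close> edges are \<open>q\<close>
  consecutive integers, then the labels \<open>p + 1, \<dots>, p + q\<close> can be given to the edges in order of
  decreasing weight, and every edge gets the same total. This is
  \<open>super_edge_magic_if_consecutive_weights\<close>; it remains to label the vertices.

  Let \<open>t = 2 s + 1\<close>. One copy of \<open>LK n\<close> consists of a centre (index \<open>0\<close>) and leaves
  \<open>1, \<dots>, n\<close>; the vertices of index \<open>i\<close> in all \<open>t\<close> copies form layer \<open>i\<close>, and the edge from the
  centre to the vertex of index \<open>i\<close> belongs to layer \<open>i\<close> too, the loop being the edge of layer \<open>0\<close>.
  Since \<open>t\<close> is odd, there is a permutation \<open>\<rho>\<close> of \<open>{1..t}\<close> for which the sums \<open>j + \<rho> j\<close> are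
  \<open>t\<close> consecutive integers. Centres with consecutive labels \<open>s + j\<close> and leaves with
  labels \<open>i t + \<rho> j\<close> therefore make the weights of layer \<open>i\<close> an interval of length \<open>t\<close>, and these
  intervals follow each other as \<open>i\<close> grows.

  The loops do not fit into this pattern, because their weights \<open>2 (s + j)\<close> leave gaps of
  size one. Layer \<open>1\<close> has to fill these gaps. As the centres occupy the middle part
  \<open>[s + 1, 3 s + 1]\<close> of \<open>[1, 2 t]\<close>, layer \<open>1\<close> receives the two remaining parts
  \<open>[1, s]\<close> and \<open>[3 s + 2, 4 s + 2]\<close>, that is, the labels \<open>\<rho> j\<close> and \<open>t + \<rho> j\<close>, according to the
  half in which \<open>j\<close> lies. Its weights are then all odd numbers from \<open>2 s + 3\<close> to \<open>6 s + 3\<close>,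
  while the loops have all even weights from \<open>2 s + 2\<close> to \<open>6 s + 2\<close>. The layers \<open>2, \<dots>, n\<close> continue
  from \<open>6 s + 4\<close>.
\<close>

section \<open>Vertex labellings with consecutive edge weights\<close>

text \<open>
  The use of \<open>Min\<close> and \<open>Max\<close> turns the weight into a function of the edge as a set, which counts
  the single end of a loop twice.
\<close>

definition edge_weight :: "('a \<Rightarrow> nat) \<Rightarrow> 'a set \<Rightarrow> nat" where
  "edge_weight g e = Min (g ` e) + Max (g ` e)"

lemma edge_weight_doubleton [simp]: "edge_weight g {x, y} = g x + g y"
  by (simp add: edge_weight_def min_def max_def)

text \<open>
  Only covering is assumed: a map from a finite set that covers a set of the same size is
  a bijection, so injectivity of the labels and of the weights comes for free.
\<close>

lemma super_edge_magic_if_consecutive_weights: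
  fixes g :: "'a \<Rightarrow> nat"
  assumes V: "finite (verts G)" and E: "finite (edges G)"
    and labels: "{1..card (verts G)} \<subseteq> g ` verts G"
    and weights: "{m..<m + card (edges G)} \<subseteq> edge_weight g ` edges G"
  shows "super_edge_magic G"
proof -
  define p q where "p = card (verts G)" and "q = card (edges G)"
  define f where "f = case_sum g (\<lambda>e. p + q + m - edge_weight g e)"
  have gV: "g ` verts G = {1..p}"
    using card_seteq[OF _ labels] V by (simp add: card_image_le p_def)
  have wE: "edge_weight g ` edges G = {m..<m + q}"
    using card_seteq[OF _ weights] E by (simp add: card_image_le q_def)
  have "(\<lambda>w. p + q + m - w) ` {m..<m + q} = {p + 1..p + q}"
  proof (intro equalityI subsetI)
    fix l assume "l \<in> {p + 1..p + q}"
    then show "l \<in> (\<lambda>w. p + q + m - w) ` {m..<m + q}"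
      by (intro image_eqI[of _ _ "p + q + m - l"]) auto
  qed auto
  then have "(\<lambda>e. p + q + m - edge_weight g e) ` edges G = {p + 1..p + q}"
    unfolding wE[symmetric] image_image .
  then have "f ` (verts G <+> edges G) = {1..p} \<union> {p + 1..p + q}"
    unfolding Plus_def image_Un image_image f_def by (simp add: gV)
  then have img: "f ` (verts G <+> edges G) = {1..p + q}"
    by auto
  then have "inj_on f (verts G <+> edges G)"
    using V E by (intro eq_card_imp_inj_on) (auto simp: card_Plus p_def q_def)
  with img have bij: "bij_betw f (verts G <+> edges G) {1..p + q}"
    by (simp add: bij_betw_def)
  have magic: "f (Inl x) + f (Inr {x, y}) + f (Inl y) = p + q + m" if "{x, y} \<in> edges G" for x y
  proof -
    have "edge_weight g {x, y} \<in> {m..<m + q}"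
      using that wE by blast
    then show ?thesis
      by (simp add: f_def)
  qed
  have "edge_magic_labeling G f (p + q + m)"
    using bij magic by (simp add: edge_magic_labeling_def p_def q_def)
  moreover have "f ` Inl ` verts G = {1..card (verts G)}"
    using gV by (simp add: f_def image_image p_def)
  ultimately show ?thesis
    unfolding super_edge_magic_def by blast
qed

section \<open>Copies of a star with a loop at its centre\<close>

lemma verts_copies_LK: "verts (copies t (LK n)) = {1..t} \<times> {0..n}"
  by (simp add: copies_def LK_def attach_loop_def star_def)

text \<open>
  The loop is the edge from the centre to the vertex of index \<open>0\<close>, so the edges are indexed by
  the same pairs as the vertices.
\<close>

lemma edges_copies_LK:
  "edges (copies t (LK n)) = (\<lambda>(j, i). {(j, 0), (j, i)}) ` ({1..t} \<times> {0..n})"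
proof -
  have "{0..n} = insert 0 {1..n}"
    by auto
  then have "edges (LK n) = (\<lambda>i. {0, i}) ` {0..n}"
    by (auto simp: LK_def attach_loop_def star_def)
  moreover have "edges (copies t (LK n)) = (\<Union>j \<in> {1..t}. (`) (Pair j) ` edges (LK n))"
    unfolding copies_def loop_graph.simps by blast
  moreover have "(\<lambda>(j, i). {(j, 0), (j, i)}) ` ({1..t} \<times> {0..n}) =
      (\<Union>j \<in> {1..t}. (\<lambda>i. {(j, 0), (j, i)}) ` {0..n})"
    by force
  ultimately show ?thesis
    by (simp only: image_image image_insert image_empty)
qed

lemma card_edges_copies_LK: "card (edges (copies t (LK n))) = t * (n + 1)"
proof -
  have "inj_on (\<lambda>(j, i). {(j, 0), (j, i)}) ({1..t} \<times> {0..n})"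
    by (auto simp: inj_on_def doubleton_eq_iff)
  then show ?thesis
    by (simp add: edges_copies_LK card_image)
qed

section \<open>The labelling\<close>

text \<open>
  This is \<open>j + s\<close> modulo \<open>2 s + 1\<close>, with representatives in \<open>[1, 2 s + 1]\<close>. The sums
  \<open>j + half_shift s j\<close> run through \<open>s + 2, s + 4, \<dots>, 3 s + 2\<close> on the first half and through
  \<open>s + 3, s + 5, \<dots>, 3 s + 1\<close> on the second half, hence together through an interval.
\<close>

definition half_shift :: "nat \<Rightarrow> nat \<Rightarrow> nat" where
  "half_shift s j = (if j \<le> s + 1 then j + s else j - (s + 1))"

text \<open>
  In layer \<open>1\<close> the second half of the copies is moved down by \<open>2 s + 1\<close>, to the labels
  \<open>1, \<dots>, s\<close> below those of the centres.
\<close>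

definition LK_label :: "nat \<Rightarrow> nat \<times> nat \<Rightarrow> nat" where
  "LK_label s = (\<lambda>(j, i).
     if i = 0 then s + j
     else if i = 1 \<and> j > s + 1 then half_shift s j
     else (2 * s + 1) * i + half_shift s j)"

lemma half_shift_surj:
  assumes "r \<in> {1..2 * s + 1}"
  obtains j where "j \<in> {1..2 * s + 1}" "half_shift s j = r"
proof (cases "r \<le> s")
  case True
  with assms show ?thesis
    by (intro that[of "r + s + 1"]) (auto simp: half_shift_def)
next
  case False
  with assms show ?thesis
    by (intro that[of "r - s"]) (auto simp: half_shift_def)
qed

lemma add_half_shift_surj:
  assumes "r \<in> {s + 2..3 * s + 2}"
  obtains j where "j \<in> {1..2 * s + 1}" "j + half_shift s j = r"
proof (cases "even (r - s)")
  case True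
  then obtain b where "r - s = 2 * b" ..
  with assms show ?thesis
    by (intro that[of b]) (auto simp: half_shift_def)
next
  case False
  then obtain b where "r - s = 2 * b + 1" ..
  with assms show ?thesis
    by (intro that[of "b + s + 1"]) (auto simp: half_shift_def)
qed

text \<open>
  Above an initial part of length \<open>2 t\<close>, which belongs to the layers \<open>0\<close> and \<open>1\<close>, both the labels
  and the weights are split into blocks of length \<open>t\<close>, one for each further layer.
\<close>

lemma block_decomposition:
  fixes d t n :: nat
  assumes "t > 0" "2 * t \<le> d" "d < t * (n + 1)"
  obtains i r where "2 \<le> i" "i \<le> n" "r < t" "d = t * i + r"
proof (rule that[of "d div t" "d mod t"])
  have "d div t < n + 1"
    using assms by (intro less_mult_imp_div_less) (simp add: mult.commute)
  then show "d div t \<le> n"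
    by simp
  show "2 \<le> d div t"
    using assms div_le_mono[of "2 * t" d t] by simp
qed (use assms in auto)

lemma LK_label_surj:
  assumes "n \<ge> 1"
  shows "{1..(2 * s + 1) * (n + 1)} \<subseteq> LK_label s ` ({1..2 * s + 1} \<times> {0..n})"
proof
  fix v assume v: "v \<in> {1..(2 * s + 1) * (n + 1)}"
  consider "v \<le> s" | "s < v" "v \<le> 3 * s + 1" | "3 * s + 1 < v" "v \<le> 2 * (2 * s + 1)"
    | "2 * (2 * s + 1) < v"
    by linarith
  then show "v \<in> LK_label s ` ({1..2 * s + 1} \<times> {0..n})"
  proof cases
    case 1
    with v assms show ?thesis
      by (intro image_eqI[of _ _ "(v + s + 1, 1)"]) (auto simp: LK_label_def half_shift_def)
  next
    case 2
    then show ?thesis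
      by (intro image_eqI[of _ _ "(v - s, 0)"]) (auto simp: LK_label_def)
  next
    case 3
    with assms show ?thesis
      by (intro image_eqI[of _ _ "(v - (3 * s + 1), 1)"]) (auto simp: LK_label_def half_shift_def)
  next
    case 4
    obtain i r where i: "2 \<le> i" "i \<le> n" and r: "r < 2 * s + 1"
      and d: "v - 1 = (2 * s + 1) * i + r"
    proof (rule block_decomposition)
      show "2 * (2 * s + 1) \<le> v - 1" "v - 1 < (2 * s + 1) * (n + 1)"
        using 4 v by (simp_all only: atLeastAtMost_iff) linarith+
    qed simp_all
    obtain j where j: "j \<in> {1..2 * s + 1}" "half_shift s j = r + 1"
      using half_shift_surj[of "r + 1" s] r by auto
    have "v = (2 * s + 1) * i + (r + 1)"
      using d 4 by linarith
    then have "v = LK_label s (j, i)"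
      using i j by (simp add: LK_label_def)
    with i j show ?thesis
      by auto
  qed
qed

lemma LK_weight_surj:
  assumes "n \<ge> 1"
  shows "{2 * s + 2..<2 * s + 2 + (2 * s + 1) * (n + 1)} \<subseteq>
    edge_weight (LK_label s) ` edges (copies (2 * s + 1) (LK n))"
proof
  fix w assume w: "w \<in> {2 * s + 2..<2 * s + 2 + (2 * s + 1) * (n + 1)}"
  define d where "d = w - (2 * s + 2)"
  have wd: "w = 2 * s + 2 + d"
    unfolding d_def using w by (intro le_add_diff_inverse[symmetric]) simp
  have "\<exists>j i. j \<in> {1..2 * s + 1} \<and> i \<le> n \<and> w = LK_label s (j, 0) + LK_label s (j, i)"
  proof (cases "d < 2 * (2 * s + 1)")
    case first_layers: True
    show ?thesis
    proof (cases "even d")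
      case True
      then obtain b where "d = 2 * b" ..
      with first_layers show ?thesis
        by (intro exI[of _ "b + 1"] exI[of _ 0]) (auto simp: LK_label_def wd)
    next
      case False
      then obtain b where b: "d = 2 * b + 1" ..
      \<comment> \<open>The lower odd weights come from the leaves with labels \<open>1, \<dots>, s\<close>.\<close>
      show ?thesis
      proof (cases "b < s")
        case True
        with b assms show ?thesis
          by (intro exI[of _ "b + s + 2"] exI[of _ 1]) (auto simp: LK_label_def half_shift_def wd)
      next
        case False
        with b first_layers assms show ?thesis
          by (intro exI[of _ "b - s + 1"] exI[of _ 1]) (auto simp: LK_label_def half_shift_def wd)
      qed
    qed
  next
    case False
    obtain i r where i: "2 \<le> i" "i \<le> n" and r: "r < 2 * s + 1"
      and d: "d = (2 * s + 1) * i + r"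
    proof (rule block_decomposition)
      show "2 * (2 * s + 1) \<le> d" "d < (2 * s + 1) * (n + 1)"
        using False w wd by (simp_all only: atLeastLessThan_iff) linarith+
    qed simp_all
    obtain j where j: "j \<in> {1..2 * s + 1}" "j + half_shift s j = s + 2 + r"
      using add_half_shift_surj[of "s + 2 + r" s] r by auto
    have "w = s + j + ((2 * s + 1) * i + half_shift s j)"
      using wd d j(2) by linarith
    then have "w = LK_label s (j, 0) + LK_label s (j, i)"
      using i by (simp add: LK_label_def)
    with i j show ?thesis
      by blast
  qed
  then obtain j i where ji: "j \<in> {1..2 * s + 1}" "i \<le> n"
    and "w = edge_weight (LK_label s) {(j, 0), (j, i)}"
    by auto
  moreover have "{(j, 0), (j, i)} \<in> edges (copies (2 * s + 1) (LK n))"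
    unfolding edges_copies_LK by (rule image_eqI[of _ _ "(j, i)"]) (use ji in auto)
  ultimately show "w \<in> edge_weight (LK_label s) ` edges (copies (2 * s + 1) (LK n))"
    by blast
qed

theorem theorem2p3:
  fixes n s :: nat
  assumes "n \<ge> 1"
  shows "super_edge_magic (copies (2 * s + 1) (LK n))"
proof (rule super_edge_magic_if_consecutive_weights)
  let ?G = "copies (2 * s + 1) (LK n)"
  show "finite (verts ?G)" "finite (edges ?G)"
    by (simp_all add: verts_copies_LK edges_copies_LK)
  have "card (verts ?G) = (2 * s + 1) * (n + 1)"
    by (simp add: verts_copies_LK)
  then show "{1..card (verts ?G)} \<subseteq> LK_label s ` verts ?G"
    using LK_label_surj[OF assms] by (simp only: verts_copies_LK)
  show "{2 * s + 2..<2 * s + 2 + card (edges ?G)} \<subseteq> edge_weight (LK_label s) ` edges ?G"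
    unfolding card_edges_copies_LK by (rule LK_weight_surj[OF assms])
qed

end
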